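(* Let $D$ be an integral domain and let $\star$ be a semistar operation on $D$. If $D$ is an $\mathtt{H}(\star)$-domain, then the following conditions are equivalent: (i) $D$ is a $\star$-domain. (ii) $D$ is a P$\star$MD.
   Context: Let $D$ be an integral domain with quotient field $K$. $\overline{\boldsymbol F}(D)$ is the set of nonzero $D$-submodules of $K$, and $\boldsymbol f(D)$ the set of nonzero finitely generated $D$-submodules of $K$. For a $D$-submodule $F$ of $K$, $F^{-1}=(D:F)=\{x\in K: xF\subseteq D\}$. A semistar operation on $D$ is a map $\star:\overline{\boldsymbol F}(D)\to\overline{\boldsymbol F}(D)$, $E\mapsto E^\star$, such that for all $0\ne x\in K$ and $E,F\in\overline{\boldsymbol F}(D)$: $(xE)^\star=xE^\star$; $E\subseteq F$ implies $E^\star\subseteq F^\star$; $E\subseteq E^\star$ and $(E^\star)^\star=E^\star$. The semistar operation $\star_f$ is $E^{\star_f}=\bigcup\{F^\star: F\in\boldsymbol f(D),\ F\subseteq E\}$. $D$ is an $\mathtt{H}(\star)$-domain if for each nonzero ideal $I$ of $D$ with $I^\star=D^\star$ there is a nonzero finitely generated ideal $J\subseteq I$ with $J^\star=D^\star$. $D$ is a $\star$-domain if $(II^{-1})^\star=D^\star$ for each $I\in\boldsymbol f(D)$. $D$ is a P$\star$MD (Prüfer $\star$-multiplication domain) if $(II^{-1})^{\star_f}=D^\star$ for each nonzero finitely generated ideal $I$ of $D$. *)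

theory Defs
  imports "HOL-Computational_Algebra.Polynomial_Factorial"
begin

text \<open>
  The integral domain \<open>D\<close> is the type \<open>'a\<close> and its quotient field \<open>K\<close> is the type
  \<open>'a fract\<close>, regarded as a \<open>D\<close>-module along the canonical embedding \<open>to_fract\<close>.  Ideals of \<open>D\<close>
  are taken, via this embedding, as the \<open>D\<close>-submodules of \<open>K\<close> contained in the image of \<open>D\<close>.
\<close>

definition fract_scale :: "'a::idom \<Rightarrow> 'a fract \<Rightarrow> 'a fract" where
  "fract_scale d x = to_fract d * x"

global_interpretation fract: module "fract_scale :: 'a::idom \<Rightarrow> 'a fract \<Rightarrow> 'a fract"
  by unfold_locales (simp_all add: fract_scale_def algebra_simps)

definition base_domain :: "'a::idom fract set" where
  "base_domain = range to_fract"

definition nonzero_submodules :: "'a::idom fract set set" where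
  "nonzero_submodules = {E. fract.subspace E \<and> E \<noteq> {0}}"

definition nonzero_fg_submodules :: "'a::idom fract set set" where
  "nonzero_fg_submodules = {F \<in> nonzero_submodules. \<exists>S. finite S \<and> F = fract.span S}"

definition nonzero_ideals :: "'a::idom fract set set" where
  "nonzero_ideals = {I \<in> nonzero_submodules. I \<subseteq> base_domain}"

definition nonzero_fg_ideals :: "'a::idom fract set set" where
  "nonzero_fg_ideals = {I \<in> nonzero_fg_submodules. I \<subseteq> base_domain}"

definition submodule_inverse :: "'a::idom fract set \<Rightarrow> 'a fract set" where
  "submodule_inverse F = {x. (*) x ` F \<subseteq> base_domain}"

definition submodule_prod :: "'a::idom fract set \<Rightarrow> 'a fract set \<Rightarrow> 'a fract set" where
  "submodule_prod E F = fract.span {x * y | x y. x \<in> E \<and> y \<in> F}"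

text \<open>
  A semistar operation is a map on \<open>nonzero_submodules\<close> only: its values on other subsets of the quotient
  field are unconstrained and never used.
\<close>

definition semistar_operation :: "('a::idom fract set \<Rightarrow> 'a fract set) \<Rightarrow> bool" where
  "semistar_operation star \<longleftrightarrow>
     (\<forall>E \<in> nonzero_submodules. star E \<in> nonzero_submodules) \<and>
     (\<forall>x. \<forall>E \<in> nonzero_submodules. x \<noteq> 0 \<longrightarrow> star ((*) x ` E) = (*) x ` star E) \<and>
     (\<forall>E \<in> nonzero_submodules. \<forall>F \<in> nonzero_submodules. E \<subseteq> F \<longrightarrow> star E \<subseteq> star F) \<and>
     (\<forall>E \<in> nonzero_submodules. E \<subseteq> star E \<and> star (star E) = star E)"

definition star_f :: "('a::idom fract set \<Rightarrow> 'a fract set) \<Rightarrow> 'a fract set \<Rightarrow> 'a fract set" where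
  "star_f star E = \<Union> {star F | F. F \<in> nonzero_fg_submodules \<and> F \<subseteq> E}"

definition H_domain :: "('a::idom fract set \<Rightarrow> 'a fract set) \<Rightarrow> bool" where
  "H_domain star \<longleftrightarrow>
     (\<forall>I \<in> nonzero_ideals. star I = star base_domain \<longrightarrow>
        (\<exists>J \<in> nonzero_fg_ideals. J \<subseteq> I \<and> star J = star base_domain))"

definition star_domain :: "('a::idom fract set \<Rightarrow> 'a fract set) \<Rightarrow> bool" where
  "star_domain star \<longleftrightarrow>
     (\<forall>I \<in> nonzero_fg_submodules.
        star (submodule_prod I (submodule_inverse I)) = star base_domain)"

definition pruefer_star_mult_domain :: "('a::idom fract set \<Rightarrow> 'a fract set) \<Rightarrow> bool" where
  "pruefer_star_mult_domain star \<longleftrightarrow>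
     (\<forall>I \<in> nonzero_fg_ideals.
        star_f star (submodule_prod I (submodule_inverse I)) = star base_domain)"

end

theory Submission
  imports Defs
begin

text \<open>
  For a finitely generated \<open>I\<close>, the product \<open>P = I I\<^sup>-\<^sup>1\<close> is a nonzero ideal, so
  \<open>P\<^sup>\<star>\<^sup>f \<subseteq> P\<^sup>\<star> \<subseteq> D\<^sup>\<star>\<close>; hence the condition for \<open>\<star>\<^sub>f\<close> implies the one for \<open>\<star>\<close>, and
  the \<open>H(\<star>)\<close>-property, applied to the ideal \<open>P\<close>, gives the converse.  The quantification over
  fractional instead of integral ideals is harmless because \<open>P\<close> does not change when \<open>I\<close> is
  multiplied by a common denominator.
\<close>

lemma to_fract_in_base_domain: "to_fract a \<in> base_domain"
  unfolding base_domain_def by (rule rangeI)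

lemma subspace_base_domain: "fract.subspace base_domain"
proof (rule fract.subspaceI)
  show "0 \<in> base_domain"
    using to_fract_in_base_domain[of 0] by simp
next
  fix x y :: "'a fract" assume "x \<in> base_domain" "y \<in> base_domain"
  then obtain a b where "x = to_fract a" "y = to_fract b"
    by (auto simp: base_domain_def)
  then show "x + y \<in> base_domain"
    using to_fract_in_base_domain[of "a + b"] by simp
next
  fix c :: 'a and x :: "'a fract" assume "x \<in> base_domain"
  then obtain a where "x = to_fract a"
    by (auto simp: base_domain_def)
  then show "fract_scale c x \<in> base_domain"
    using to_fract_in_base_domain[of "c * a"] by (simp add: fract_scale_def)
qed

lemma base_domain_nonzero_submodule: "base_domain \<in> nonzero_submodules"
proof -
  have "(1 :: 'a fract) \<in> base_domain"
    using to_fract_in_base_domain[of 1] by simp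
  then have "base_domain \<noteq> {0 :: 'a fract}" by (metis singletonD zero_neq_one)
  then show ?thesis
    using subspace_base_domain by (simp add: nonzero_submodules_def)
qed

lemma nonzero_submodule_has_nonzero:
  assumes "E \<in> nonzero_submodules"
  obtains x where "x \<in> E" "x \<noteq> 0"
  using assms fract.subspace_0[of E] unfolding nonzero_submodules_def by blast

text \<open>Multiplication by \<open>c\<close> is \<open>D\<close>-linear on \<open>K\<close>, and
  linear maps commute with spans. This reduces statements about \<open>c F\<close> to statements
  about finitely many generators.\<close>

lemma mult_image_span: "(*) c ` fract.span S = fract.span ((*) c ` S)"
proof -
  interpret module_hom fract_scale fract_scale "(*) c"
    by unfold_locales (simp_all add: fract_scale_def algebra_simps)
  show ?thesis by (simp add: span_image)
qed

text \<open>Induction on \<open>S\<close>: the product of the denominators of the elements clears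
  all of them at once.\<close>

lemma finite_common_denominator:
  assumes "finite S"
  shows "\<exists>d. d \<noteq> 0 \<and> (*) (to_fract d) ` S \<subseteq> base_domain"
  using assms
proof induction
  case empty
  show ?case by (rule exI[of _ 1]) simp
next
  case (insert x S)
  then obtain d where d: "d \<noteq> 0" "(*) (to_fract d) ` S \<subseteq> base_domain" by blast
  obtain a b where x: "x = Fract a b" "b \<noteq> 0" by (cases x)
  \<comment> \<open>The new multiplier is \<open>b * d\<close>: the factor \<open>b\<close> cancels
    the denominator of \<open>x\<close>, while \<open>d\<close> already clears the elements of
    \<open>S\<close>.\<close>
  have "to_fract (b * d) * x = to_fract (d * a)"
    using x by (simp add: to_fract_def eq_fract)
  moreover have "to_fract (b * d) * y \<in> base_domain" if "y \<in> S" for y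
  proof -
    have "fract_scale b (to_fract d * y) \<in> base_domain"
      using d that by (intro fract.subspace_scale[OF subspace_base_domain]) auto
    then show ?thesis by (simp add: fract_scale_def mult.assoc)
  qed
  moreover have "to_fract (d * a) \<in> base_domain" by (rule to_fract_in_base_domain)
  ultimately have "(*) (to_fract (b * d)) ` insert x S \<subseteq> base_domain"
    by (auto simp del: to_fract_mult)
  then show ?case using d x by (metis mult_eq_0_iff)
qed

text \<open>Clearing the denominators of a finite generating set is enough, because \<open>D\<close>
  is itself a submodule and so contains the span of the cleared generators.\<close>

lemma fg_submodule_common_denominator:
  assumes "F \<in> nonzero_fg_submodules"
  obtains d where "d \<noteq> 0" "(*) (to_fract d) ` F \<subseteq> base_domain"
proof -
  obtain S where S: "finite S" "F = fract.span S"
    using assms by (auto simp: nonzero_fg_submodules_def)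
  obtain d where d: "d \<noteq> 0" "(*) (to_fract d) ` S \<subseteq> base_domain"
    using finite_common_denominator[OF S(1)] by blast
  have "(*) (to_fract d) ` F \<subseteq> base_domain"
    unfolding S(2) mult_image_span by (rule fract.span_minimal[OF d(2) subspace_base_domain])
  with d show ?thesis using that by blast
qed

lemma mult_image_nonzero_fg_submodule:
  assumes "F \<in> nonzero_fg_submodules" "c \<noteq> 0"
  shows "(*) c ` F \<in> nonzero_fg_submodules"
proof -
  obtain S where S: "finite S" "F = fract.span S"
    using assms by (auto simp: nonzero_fg_submodules_def)
  obtain x where "x \<in> F" "x \<noteq> 0"
    using assms nonzero_submodule_has_nonzero by (auto simp: nonzero_fg_submodules_def)
  then have "c * x \<in> (*) c ` F" "c * x \<noteq> 0"
    using assms(2) by simp_all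
  then have "(*) c ` F \<noteq> {0}" by (metis singletonD)
  moreover have "(*) c ` F = fract.span ((*) c ` S)"
    by (simp add: S mult_image_span)
  moreover have "finite ((*) c ` S)" using S(1) by simp
  ultimately show ?thesis
    unfolding nonzero_fg_submodules_def nonzero_submodules_def
    using fract.subspace_span[of "(*) c ` S"]
    by (intro CollectI conjI exI[of _ "(*) c ` S"]) simp_all
qed

text \<open>Scaling \<open>I\<close> by \<open>c\<close> scales its inverse by \<open>1 / c\<close>,
  so the two factors cancel in each product of generators.\<close>

lemma mult_image_prod_inverse:
  assumes "c \<noteq> 0"
  shows "submodule_prod ((*) c ` I) (submodule_inverse ((*) c ` I))
       = submodule_prod I (submodule_inverse I)"
proof -
  have inv: "y \<in> submodule_inverse ((*) c ` I) \<longleftrightarrow> c * y \<in> submodule_inverse I" for y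
    by (auto simp: submodule_inverse_def image_image mult_ac)
  have "{x * y |x y. x \<in> (*) c ` I \<and> y \<in> submodule_inverse ((*) c ` I)}
      = {x * y |x y. x \<in> I \<and> y \<in> submodule_inverse I}" (is "?A = ?B")
  proof (intro equalityI subsetI)
    fix z assume "z \<in> ?A"
    then obtain x y where "x \<in> I" "y \<in> submodule_inverse ((*) c ` I)" "z = c * x * y"
      by blast
    then have "c * y \<in> submodule_inverse I" "z = x * (c * y)"
      by (simp_all add: inv)
    then show "z \<in> ?B" using \<open>x \<in> I\<close> by blast
  next
    fix z assume "z \<in> ?B"
    then obtain x y where "x \<in> I" "y \<in> submodule_inverse I" "z = x * y" by blast
    then have "z = (c * x) * (y / c)" "y / c \<in> submodule_inverse ((*) c ` I)"
      using assms by (simp_all add: inv)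
    then show "z \<in> ?A" using \<open>x \<in> I\<close> by blast
  qed
  then show ?thesis by (simp add: submodule_prod_def)
qed

text \<open>Containment in \<open>D\<close> is immediate from the definition of the inverse. Finite
  generation serves to make the product nonzero: a common denominator of \<open>I\<close> is a
  nonzero element of the inverse.\<close>

lemma prod_inverse_nonzero_ideal:
  assumes "I \<in> nonzero_fg_submodules"
  shows "submodule_prod I (submodule_inverse I) \<in> nonzero_ideals"
proof -
  obtain d where d: "d \<noteq> 0" "(*) (to_fract d) ` I \<subseteq> base_domain"
    using fg_submodule_common_denominator[OF assms] .
  obtain x where x: "x \<in> I" "x \<noteq> 0"
    using assms nonzero_submodule_has_nonzero by (auto simp: nonzero_fg_submodules_def)
  have "to_fract d \<in> submodule_inverse I" using d by (simp add: submodule_inverse_def)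
  then have "x * to_fract d \<in> submodule_prod I (submodule_inverse I)"
    unfolding submodule_prod_def using x by (intro fract.span_base) blast
  moreover have "x * to_fract d \<noteq> 0" using x d by simp
  moreover have "submodule_prod I (submodule_inverse I) \<subseteq> base_domain"
    unfolding submodule_prod_def
    by (intro fract.span_minimal subspace_base_domain)
      (auto simp: submodule_inverse_def mult.commute)
  ultimately show ?thesis
    by (auto simp: nonzero_ideals_def nonzero_submodules_def submodule_prod_def)
qed

text \<open>Every \<open>star F\<close> in the union defining \<open>star_f star E\<close> has
  \<open>F \<subseteq> E\<close>, so monotonicity applies.\<close>

lemma star_f_subset_star:
  assumes "semistar_operation star" "E \<in> nonzero_submodules"
  shows "star_f star E \<subseteq> star E"
  using assms unfolding semistar_operation_def star_f_def nonzero_fg_submodules_def by blast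

lemma star_ideal_subset_star_base_domain:
  assumes "semistar_operation star" "I \<in> nonzero_ideals"
  shows "star I \<subseteq> star base_domain"
  using assms base_domain_nonzero_submodule
  unfolding semistar_operation_def nonzero_ideals_def by blast

lemma star_eq_of_star_f_eq:
  assumes "semistar_operation star" "P \<in> nonzero_ideals" "star_f star P = star base_domain"
  shows "star P = star base_domain"
proof -
  have "P \<in> nonzero_submodules" using assms(2) by (simp add: nonzero_ideals_def)
  then show ?thesis
    using star_f_subset_star[OF assms(1)] star_ideal_subset_star_base_domain[OF assms(1,2)]
      assms(3) by blast
qed

text \<open>The ideal \<open>J\<close> supplied by the \<open>H_domain\<close> property is one of
  the finitely generated submodules of \<open>P\<close> in the union, so \<open>star J\<close>,
  which is all of \<open>star base_domain\<close>, already lies in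
  \<open>star_f star P\<close>.\<close>

lemma star_f_eq_of_star_eq:
  assumes "semistar_operation star" "H_domain star"
    and "P \<in> nonzero_ideals" "star P = star base_domain"
  shows "star_f star P = star base_domain"
proof -
  obtain J where J: "J \<in> nonzero_fg_ideals" "J \<subseteq> P" "star J = star base_domain"
    using assms unfolding H_domain_def by blast
  have "star J \<subseteq> star_f star P"
    using J unfolding star_f_def nonzero_fg_ideals_def by blast
  moreover have "star_f star P \<subseteq> star P"
    using assms by (intro star_f_subset_star) (simp_all add: nonzero_ideals_def)
  ultimately show ?thesis using J(3) assms(4) by blast
qed

theorem corollary6:
  fixes star :: "'a::idom fract set \<Rightarrow> 'a fract set"
  assumes "semistar_operation star"
    and "H_domain star"
  shows "star_domain star \<longleftrightarrow> pruefer_star_mult_domain star"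
proof
  assume "star_domain star"
  \<comment> \<open>Finitely generated ideals are in particular finitely generated submodules, so no
    denominators need clearing in this direction.\<close>
  then show "pruefer_star_mult_domain star"
    unfolding star_domain_def pruefer_star_mult_domain_def nonzero_fg_ideals_def
    using star_f_eq_of_star_eq[OF assms] prod_inverse_nonzero_ideal by blast
next
  assume P: "pruefer_star_mult_domain star"
  show "star_domain star"
    unfolding star_domain_def
  proof
    fix I :: "'a fract set" assume I: "I \<in> nonzero_fg_submodules"
    obtain d where d: "d \<noteq> 0" "(*) (to_fract d) ` I \<subseteq> base_domain"
      using fg_submodule_common_denominator[OF I] .
    then have nz: "to_fract d \<noteq> 0" by simp
    \<comment> \<open>The hypothesis speaks only of ideals inside \<open>D\<close>, so it is applied
      to \<open>d I\<close> and carried back to \<open>I\<close> by the invariance of the product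
      under scaling.\<close>
    have "(*) (to_fract d) ` I \<in> nonzero_fg_ideals"
      using mult_image_nonzero_fg_submodule[OF I nz] d by (simp add: nonzero_fg_ideals_def)
    then have "star_f star (submodule_prod I (submodule_inverse I)) = star base_domain"
      using P mult_image_prod_inverse[OF nz, of I]
      unfolding pruefer_star_mult_domain_def by metis
    then show "star (submodule_prod I (submodule_inverse I)) = star base_domain"
      using star_eq_of_star_f_eq[OF assms(1) prod_inverse_nonzero_ideal[OF I]] by blast
  qed
qed

end
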